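(* Let $\Omega=\{\omega_1,\dots,\omega_k\}\subseteq\mathbb{R}^n$, let $q\in\mathbb{R}^k$ with all $q_i>0$, and let $\theta$ be in the relative interior of $\operatorname{conv}\Omega$. Then there exists $x\in W$ with $\|x\|_2\le\frac{\log\beta}{r_\theta}$ such that $F_\theta(x)=F_\theta^*$.
   Context: $\log$ is the natural logarithm. $F_\theta(x)=\log\sum_{i=1}^k q_i e^{\langle \omega_i-\theta,x\rangle}$ for $x\in\mathbb{R}^n$, $F_\theta^*=\inf_{x\in\mathbb{R}^n}F_\theta(x)$, $\beta=\|q\|_1/\min_{i\in[k]}q_i$. $W$ is the linear span of the vectors $\omega_i-\theta$, $i\in[k]$. $r_\theta=\max\{r\ge 0: B(\theta,r)\cap\operatorname{aff}\Omega\subseteq\operatorname{conv}\Omega\}$ is the Euclidean distance from $\theta$ to the relative boundary of $\operatorname{conv}\Omega$ ($B$ = closed Euclidean ball, $\operatorname{aff}$ = affine hull); $\Omega$ is assumed to contain at least two points so that $r_\theta$ is well-defined. *)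

theory Defs
  imports "HOL-Analysis.Analysis"
begin

text \<open>
  The families \<omega> and q are indexed by {1..k}; values outside that range are never used.
  The point set is \<Omega> = \<omega> ` {1..k}, and \<omega> need not be injective.
\<close>

definition F_obj ::
    "nat \<Rightarrow> (nat \<Rightarrow> real ^ 'n) \<Rightarrow> (nat \<Rightarrow> real) \<Rightarrow> real ^ 'n \<Rightarrow> real ^ 'n \<Rightarrow> real" where
  "F_obj k \<omega> q \<theta> x = ln (\<Sum>i=1..k. q i * exp ((\<omega> i - \<theta>) \<bullet> x))"

text \<open>
  The infimum is taken in the extended reals, so that it is -\<infinity> (and not an arbitrary real
  number) for those \<theta> for which the objective is unbounded below.
\<close>

definition F_inf ::
    "nat \<Rightarrow> (nat \<Rightarrow> real ^ 'n) \<Rightarrow> (nat \<Rightarrow> real) \<Rightarrow> real ^ 'n \<Rightarrow> ereal" where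
  "F_inf k \<omega> q \<theta> = (INF x. ereal (F_obj k \<omega> q \<theta> x))"

definition beta :: "nat \<Rightarrow> (nat \<Rightarrow> real) \<Rightarrow> real" where
  "beta k q = (\<Sum>i=1..k. \<bar>q i\<bar>) / Min (q ` {1..k})"

definition W_space :: "nat \<Rightarrow> (nat \<Rightarrow> real ^ 'n) \<Rightarrow> real ^ 'n \<Rightarrow> (real ^ 'n) set" where
  "W_space k \<omega> \<theta> = span ((\<lambda>i. \<omega> i - \<theta>) ` {1..k})"

text \<open>
  The maximum exists whenever \<Omega> is finite with at least two points and \<theta> lies in its convex
  hull; it is then the distance from \<theta> to the relative boundary of the convex hull.
\<close>

definition r_theta :: "(real ^ 'n) set \<Rightarrow> real ^ 'n \<Rightarrow> real" where
  "r_theta \<Omega> \<theta> =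
     (GREATEST r. 0 \<le> r \<and> cball \<theta> r \<inter> affine hull \<Omega> \<subseteq> convex hull \<Omega>)"

end

theory Submission
  imports Defs
begin

text \<open>
  For x in W the point \<theta> + r x / |x| lies in conv \<Omega>, where r is the radius of \<theta>, so
  some generator satisfies (\<omega> i - \<theta>) \<bullet> x \<ge> r |x|.  Hence F x \<ge> ln (min q) + r |x|, which exceeds
  F 0 = ln (sum q) as soon as |x| > ln \<beta> / r.  Since F is invariant under orthogonal projection
  onto W, a minimiser over the compact set W \<inter> cball 0 (ln \<beta> / r) is a global one.
\<close>

text \<open>The base point \<open>a\<close> need not belong to \<open>S\<close>. Adjoining it leaves
  the affine hull unchanged and adds only the zero vector to the generators of the span.\<close>

lemma mem_affine_hull_iff_diff_mem_span:
  fixes a :: "'a::euclidean_space"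
  assumes "a \<in> affine hull S"
  shows "y \<in> affine hull S \<longleftrightarrow> y - a \<in> span ((\<lambda>x. x - a) ` S)"
proof -
  have "affine hull S = affine hull (insert a S)"
    using assms by (simp add: hull_redundant)
  then have "(\<lambda>x. x - a) ` (affine hull S) = span ((\<lambda>x. x - a) ` insert a S)"
    using diffs_affine_hull_span[of a "insert a S"] by simp
  also have "\<dots> = span ((\<lambda>x. x - a) ` S)"
    by (simp add: span_insert_0)
  finally show ?thesis
    by force
qed

text \<open>Otherwise \<open>S\<close> would lie in the open half-space of points \<open>z\<close>
  with \<open>x \<bullet> z < x \<bullet> y\<close>. That set is convex, so it would contain the
  whole hull and hence \<open>y\<close> itself.\<close>

lemma convex_hull_inner_le_generator:
  fixes y :: "'a::real_inner"
  assumes "y \<in> convex hull S"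
  obtains s where "s \<in> S" "y \<bullet> x \<le> s \<bullet> x"
proof -
  have "\<not> S \<subseteq> {z. x \<bullet> z < x \<bullet> y}"
    using assms hull_minimal[of S "{z. x \<bullet> z < x \<bullet> y}" convex] convex_halfspace_lt[of x "x \<bullet> y"]
    by blast
  then show thesis
    using that by (force simp: inner_commute)
qed

text \<open>This splits the containment into one condition per unit direction \<open>u\<close>, each
  of which depends continuously on \<open>r\<close>. It serves both to show that a largest radius
  exists and to produce the hull point at distance \<open>r\<close> in a chosen direction.\<close>

lemma cball_inter_affine_hull_subset_iff:
  fixes a :: "'a::euclidean_space"
  assumes "a \<in> convex hull S" "0 \<le> r"
  shows "cball a r \<inter> affine hull S \<subseteq> convex hull S \<longleftrightarrow>
    (\<forall>u \<in> span ((\<lambda>x. x - a) ` S) \<inter> sphere 0 1. a + r *\<^sub>R u \<in> convex hull S)"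
    (is "?L \<longleftrightarrow> (\<forall>u \<in> ?W \<inter> _. _)")
proof -
  have aff: "a \<in> affine hull S"
    using assms(1) convex_hull_subset_affine_hull by blast
  note iff = mem_affine_hull_iff_diff_mem_span[OF aff]
  show ?thesis
  proof (intro iffI ballI subsetI)
    fix u assume ?L and u: "u \<in> ?W \<inter> sphere 0 1"
    have "a + r *\<^sub>R u \<in> cball a r"
      using u assms(2) by (simp add: dist_norm)
    moreover have "a + r *\<^sub>R u \<in> affine hull S"
      using u by (simp add: iff span_scale)
    ultimately show "a + r *\<^sub>R u \<in> convex hull S"
      using \<open>?L\<close> by blast
  next
    fix y assume R: "\<forall>u \<in> ?W \<inter> sphere 0 1. a + r *\<^sub>R u \<in> convex hull S"
      and y: "y \<in> cball a r \<inter> affine hull S"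
    show "y \<in> convex hull S"
    proof (cases "y = a")
      case False
      define d where "d = norm (y - a)"
      define u where "u = (y - a) /\<^sub>R d"
      have d: "0 < d" "d \<le> r"
        using False y by (auto simp: d_def dist_norm norm_minus_commute)
      have "u \<in> ?W \<inter> sphere 0 1"
        using y d by (simp add: u_def iff span_scale) (simp add: d_def)
      then have "a + r *\<^sub>R u \<in> convex hull S"
        using R by blast
      \<comment> \<open>\<open>y\<close> lies on the segment from \<open>a\<close> to
        \<open>a + r *\<^sub>R u\<close>, at the fraction \<open>d / r\<close>; here
        \<open>r\<close> is nonzero because 0 < d \<le> r.\<close>
      then have "(1 - d / r) *\<^sub>R a + (d / r) *\<^sub>R (a + r *\<^sub>R u) \<in> convex hull S"
        using assms(1) d by (intro convexD[OF convex_convex_hull]) auto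
      also have "(1 - d / r) *\<^sub>R a + (d / r) *\<^sub>R (a + r *\<^sub>R u) = y"
        using d by (simp add: u_def algebra_simps)
      finally show ?thesis .
    qed (use assms(1) in simp)
  qed
qed

text \<open>\<open>GREATEST\<close> is informative only if the maximum is attained. The admissible
  radii form a compact set, and relative interiority supplies a positive one.\<close>

lemma
  fixes \<Omega> :: "(real ^ 'n) set"
  assumes fin: "finite \<Omega>" and two_points: "card \<Omega> \<ge> 2"
    and theta: "\<theta> \<in> rel_interior (convex hull \<Omega>)"
  shows r_theta_pos: "0 < r_theta \<Omega> \<theta>"
    and cball_r_theta_subset: "cball \<theta> (r_theta \<Omega> \<theta>) \<inter> affine hull \<Omega> \<subseteq> convex hull \<Omega>"
proof -
  let ?W = "span ((\<lambda>x. x - \<theta>) ` \<Omega>)"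
  let ?P = "\<lambda>r. 0 \<le> r \<and> cball \<theta> r \<inter> affine hull \<Omega> \<subseteq> convex hull \<Omega>"
  have conv: "\<theta> \<in> convex hull \<Omega>"
    using theta rel_interior_subset by blast
  obtain e where e: "0 < e" "?P e"
    using theta by (auto simp: mem_rel_interior_cball)
  \<comment> \<open>A point other than \<theta> gives a unit direction in the span; if there were
    none, every radius would be admissible.\<close>
  have "\<not> \<Omega> \<subseteq> {\<theta>}"
    using two_points card_mono[of "{\<theta>}" \<Omega>] by auto
  then obtain p where p: "p \<in> \<Omega>" "p \<noteq> \<theta>"
    by blast
  define u where "u = (p - \<theta>) /\<^sub>R norm (p - \<theta>)"
  have u: "u \<in> ?W \<inter> sphere 0 1"
    using p by (simp add: u_def span_scale span_base)
  \<comment> \<open>An intersection of preimages of the compact hull under the continuous maps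
    \<open>r \<mapsto> \<theta> + r *\<^sub>R u\<close>, hence closed.\<close>
  have P_eq: "Collect ?P =
      {0..} \<inter> (\<Inter>u \<in> ?W \<inter> sphere 0 1. (\<lambda>r. \<theta> + r *\<^sub>R u) -` (convex hull \<Omega>))"
    using cball_inter_affine_hull_subset_iff[OF conv] by auto
  have compact_hull: "compact (convex hull \<Omega>)"
    using fin by (simp add: finite_imp_compact_convex_hull)
  have "closed (Collect ?P)"
    unfolding P_eq
    by (intro closed_Int closed_INT ballI continuous_closed_vimage compact_imp_closed[OF compact_hull]
        closed_atLeast continuous_intros)
  moreover have "bounded (Collect ?P)"
  proof -
    obtain B where B: "\<And>y. y \<in> convex hull \<Omega> \<Longrightarrow> norm y \<le> B"
      using compact_imp_bounded[OF compact_hull] by (auto simp: bounded_iff)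
    \<comment> \<open>The single direction \<open>u\<close> suffices, since moving by
      \<open>r\<close> along it must stay in the bounded hull.\<close>
    have "norm r \<le> B + norm \<theta>" if "?P r" for r
    proof -
      have "\<theta> + r *\<^sub>R u \<in> convex hull \<Omega>"
        using that u P_eq by blast
      then have "norm (\<theta> + r *\<^sub>R u) \<le> B"
        by (rule B)
      moreover have "norm (r *\<^sub>R u) \<le> norm (\<theta> + r *\<^sub>R u) + norm \<theta>"
        using norm_triangle_ineq4[of "\<theta> + r *\<^sub>R u" \<theta>] by simp
      ultimately show ?thesis
        using u by simp
    qed
    then show ?thesis
      by (auto simp: bounded_iff)
  qed
  ultimately have "compact (Collect ?P)"
    by (simp add: compact_eq_bounded_closed)
  then obtain R where R: "?P R" "\<And>r. ?P r \<Longrightarrow> r \<le> R"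
    using compact_attains_sup[of "Collect ?P"] e by blast
  have "r_theta \<Omega> \<theta> = R"
    unfolding r_theta_def by (rule Greatest_equality) (use R in auto)
  moreover have "0 < R"
    using R(2)[OF e(2)] e(1) by linarith
  ultimately show "0 < r_theta \<Omega> \<theta>"
    and "cball \<theta> (r_theta \<Omega> \<theta>) \<inter> affine hull \<Omega> \<subseteq> convex hull \<Omega>"
    using R(1) by simp_all
qed

lemma exists_inner_ge_radius:
  fixes a :: "'a::euclidean_space"
  assumes "a \<in> convex hull S" "0 \<le> r" "cball a r \<inter> affine hull S \<subseteq> convex hull S"
    and x: "x \<in> span ((\<lambda>s. s - a) ` S)"
  obtains s where "s \<in> S" "r * norm x \<le> (s - a) \<bullet> x"
proof (cases "x = 0")
  case True
  have "S \<noteq> {}"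
    using assms(1) by auto
  then show thesis
    using that True by auto
next
  case False
  let ?u = "x /\<^sub>R norm x"
  have "?u \<in> span ((\<lambda>s. s - a) ` S) \<inter> sphere 0 1"
    using x False by (simp add: span_scale)
  then have "a + r *\<^sub>R ?u \<in> convex hull S"
    using cball_inter_affine_hull_subset_iff[OF assms(1,2)] assms(3) by blast
  then obtain s where s: "s \<in> S" "(a + r *\<^sub>R ?u) \<bullet> x \<le> s \<bullet> x"
    by (rule convex_hull_inner_le_generator)
  have "(r *\<^sub>R ?u) \<bullet> x = r * norm x"
    using False by (simp add: dot_square_norm power2_eq_square)
  with s show thesis
    by (intro that[of s]) (simp_all only: inner_add_left inner_diff_left le_diff_eq add.commute)
qed

theorem corollary2p3:
  fixes k :: nat and \<omega> :: "nat \<Rightarrow> real ^ 'n" and q :: "nat \<Rightarrow> real"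
    and \<Omega> :: "(real ^ 'n) set" and \<theta> :: "real ^ 'n"
  assumes Omega: "\<Omega> = \<omega> ` {1..k}"
    and two_points: "card \<Omega> \<ge> 2"
    and q_pos: "\<And>i. i \<in> {1..k} \<Longrightarrow> q i > 0"
    and theta: "\<theta> \<in> rel_interior (convex hull \<Omega>)"
  shows "\<exists>x \<in> W_space k \<omega> \<theta>.
           norm x \<le> ln (beta k q) / r_theta \<Omega> \<theta> \<and>
           ereal (F_obj k \<omega> q \<theta> x) = F_inf k \<omega> q \<theta>"
proof -
  let ?F = "F_obj k \<omega> q \<theta>"
  define r where "r = r_theta \<Omega> \<theta>"
  define m where "m = Min (q ` {1..k})"
  define Q where "Q = (\<Sum>i=1..k. q i)"
  define R where "R = ln (beta k q) / r"
  define W where "W = W_space k \<omega> \<theta>"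
  have W_eq: "W = span ((\<lambda>s. s - \<theta>) ` \<Omega>)"
    by (simp add: W_def W_space_def Omega image_image)
  have fin: "finite \<Omega>"
    by (simp add: Omega)
  have r: "0 < r" "cball \<theta> r \<inter> affine hull \<Omega> \<subseteq> convex hull \<Omega>"
    unfolding r_def using r_theta_pos cball_r_theta_subset fin two_points theta by blast+
  have conv: "\<theta> \<in> convex hull \<Omega>"
    using theta rel_interior_subset by blast
  \<comment> \<open>This rules out \<open>k = 0\<close>, where \<open>Min\<close> would be taken
    over the empty set.\<close>
  have ne: "{1..k} \<noteq> {}"
    using two_points Omega by (metis card.empty image_empty not_numeral_le_zero)
  have m_le: "m \<le> q i" if "i \<in> {1..k}" for i
    unfolding m_def using that by simp
  have "m \<in> q ` {1..k}"
    unfolding m_def using ne by (intro Min_in) auto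
  then obtain j where j: "j \<in> {1..k}" "m = q j"
    by blast
  have m: "0 < m"
    using j q_pos by simp
  have "m \<le> Q"
    unfolding Q_def j(2) using j(1) q_pos by (intro member_le_sum) (auto intro: less_imp_le)
  have "(\<Sum>i=1..k. \<bar>q i\<bar>) = Q"
    unfolding Q_def using q_pos by (intro sum.cong) (auto simp: abs_of_pos)
  then have beta: "beta k q = Q / m"
    by (simp add: beta_def m_def)
  \<comment> \<open>Since m \<le> Q, the quotient \<open>beta k q\<close> is at least 1 and its
    logarithm is nonnegative. This puts 0 into the search ball below.\<close>
  have R0: "0 \<le> R"
    using \<open>m \<le> Q\<close> m r(1) by (simp add: R_def beta)
  have weights_pos: "0 < (\<Sum>i=1..k. q i * exp ((\<omega> i - \<theta>) \<bullet> x))" for x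
    using ne q_pos by (intro sum_pos) auto
  have F_lower: "ln m + r * norm x \<le> ?F x" if "x \<in> W" for x
  proof -
    have "x \<in> span ((\<lambda>s. s - \<theta>) ` \<Omega>)"
      using that by (simp add: W_eq)
    then obtain s where "s \<in> \<Omega>" "r * norm x \<le> (s - \<theta>) \<bullet> x"
      using exists_inner_ge_radius[OF conv _ r(2)] r(1) by (metis less_imp_le)
    then obtain i where i: "i \<in> {1..k}" "r * norm x \<le> (\<omega> i - \<theta>) \<bullet> x"
      unfolding Omega by blast
    \<comment> \<open>The term of index \<open>i\<close> alone gives the bound, as all the other
      terms of the sum are positive.\<close>
    have "m * exp (r * norm x) \<le> q i * exp ((\<omega> i - \<theta>) \<bullet> x)"
      using i m m_le q_pos by (intro mult_mono) (auto intro: less_imp_le)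
    also have "\<dots> \<le> (\<Sum>i=1..k. q i * exp ((\<omega> i - \<theta>) \<bullet> x))"
      using i(1) q_pos by (intro member_le_sum) (auto intro: less_imp_le)
    finally have "ln (m * exp (r * norm x)) \<le> ?F x"
      unfolding F_obj_def using m weights_pos[of x] by simp
    then show ?thesis
      using m by (simp add: ln_mult)
  qed
  have F0: "?F 0 = ln Q"
    by (simp add: F_obj_def Q_def)
  \<comment> \<open>\<open>R\<close> is the radius at which the lower bound
    \<open>ln m + r * norm x\<close> reaches \<open>ln Q\<close>, the value at 0.\<close>
  have F_far: "?F 0 < ?F x" if "x \<in> W" "R < norm x" for x
  proof -
    have "ln Q - ln m < r * norm x"
      using that(2) r(1) m \<open>m \<le> Q\<close>
      by (simp add: R_def beta ln_div pos_divide_less_eq mult.commute)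
    then show ?thesis
      using F_lower[OF that(1)] F0 by simp
  qed
  have F_proj: "\<exists>y\<in>W. ?F x = ?F y" for x
  proof -
    obtain y z where yz: "y \<in> W" "\<And>w. w \<in> W \<Longrightarrow> orthogonal z w" "x = y + z"
      using orthogonal_subspace_decomp_exists[of "(\<lambda>s. s - \<theta>) ` \<Omega>" x]
      unfolding W_eq by metis
    \<comment> \<open>The component \<open>z\<close> is orthogonal to every exponent vector, so it
      does not affect the objective.\<close>
    have "(\<omega> i - \<theta>) \<bullet> x = (\<omega> i - \<theta>) \<bullet> y" if "i \<in> {1..k}" for i
    proof -
      have "\<omega> i - \<theta> \<in> W"
        unfolding W_eq Omega using that by (intro span_base) auto
      then have "z \<bullet> (\<omega> i - \<theta>) = 0"
        using yz(2) by (simp add: orthogonal_def)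
      then show ?thesis
        by (simp add: yz(3) inner_add_right inner_commute[of _ z])
    qed
    then have "?F x = ?F y"
      unfolding F_obj_def by simp
    then show ?thesis
      using yz(1) by blast
  qed
  let ?K = "W \<inter> cball 0 R"
  have "compact ?K"
    unfolding W_eq by (intro closed_Int_compact closed_span compact_cball)
  moreover have zero: "0 \<in> ?K"
    using R0 by (simp add: W_eq span_zero)
  moreover have "continuous_on ?K ?F"
    unfolding F_obj_def using weights_pos by (intro continuous_intros) (simp add: less_imp_neq[symmetric])
  ultimately obtain x where x: "x \<in> ?K" "\<And>y. y \<in> ?K \<Longrightarrow> ?F x \<le> ?F y"
    using continuous_attains_inf[of ?K ?F] by blast
  have min: "?F x \<le> ?F y" for y
  proof -
    obtain z where z: "z \<in> W" "?F y = ?F z"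
      using F_proj by blast
    \<comment> \<open>If \<open>z\<close> lies in the ball, minimality of \<open>x\<close> on
      \<open>?K\<close> applies. Otherwise the value at \<open>z\<close> exceeds the value at 0,
      which is itself at least the value at \<open>x\<close>.\<close>
    show ?thesis
      using x(2)[of z] x(2)[OF zero] F_far[of z] z by (cases "norm z \<le> R") auto
  qed
  have "ereal (?F x) = F_inf k \<omega> q \<theta>"
    unfolding F_inf_def using min by (intro antisym INF_greatest INF_lower) auto
  then show ?thesis
    using x(1) by (intro bexI[of _ x]) (auto simp: W_def R_def r_def)
qed

end
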